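(* Let $\rho_0\in\mathcal{P}_2(\mathbb{R})$ and $v_0\in L^2(\rho_0)$, let $N_0$ be the optimal map of $\rho_0$ and $V_0=v_0\circ N_0$. The sticky particle solution of the pressureless Euler system with initial conditions given by $(N_0,V_0)$ converges to equilibrium as $t\to\infty$ if and only if $$\int_0^1 V_0(w)\,dw=0\quad\text{and}\quad \int_0^x V_0(w)\,dw\ge 0\quad\text{for all } x\in(0,1).$$
   Context: $\mathcal{P}_2(\mathbb{R})$ is the set of Borel probability measures on $\mathbb{R}$ with finite second moment; $\mathcal{L}$ is Lebesgue measure on $(0,1)$; $W_1$ is the 1-Wasserstein distance. The optimal map of a probability measure $\mu$ on $\mathbb{R}$ is the unique nondecreasing right-continuous function $N$ on $(0,1)$ with $N_\#\mathcal{L}=\mu$ (push-forward). If $\mu_1,\mu_2$ have optimal maps $N_1,N_2$, then $W_1(\mu_1,\mu_2)=\|N_1-N_2\|_{L^1(0,1)}$. The pressureless Euler system in one dimension is $\partial_t\rho+\partial_y(\rho v)=0$, $\partial_t(\rho v)+\partial_y(\rho v^2)=0$. Let $\mathcal{K}\subset L^2(0,1)$ be the closed convex cone of (a.e. classes of) nondecreasing functions and $\operatorname{proj}_{\mathcal K}$ the $L^2(0,1)$-orthogonal projection onto $\mathcal K$. It is computed by $\operatorname{proj}_{\mathcal K}f(x)=\frac{d^+}{dx}\Phi^{**}(x)$, where $\Phi(x)=\int_0^x f(w)\,dw$, $\Phi^{**}$ is the convex envelope of $\Phi$ on $[0,1]$ (greatest convex function bounded above by $\Phi$), and $\frac{d^+}{dx}$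 is the right derivative; this nondecreasing right-continuous representative is always used. "The sticky particle solution" with initial conditions $(\rho_0,v_0)$ (equivalently, given by $(N_0,V_0)$) means the solution generated by the projection formula: $N_t=\operatorname{proj}_{\mathcal K}(N_0+tV_0)$ and $\rho_t=(N_t)_\#\mathcal{L}$ for $t\ge0$. The solution converges (goes) to equilibrium if $W_1(\rho_t,\rho_\infty)\to0$ as $t\to\infty$ for some $\rho_\infty\in\mathcal{P}_2(\mathbb{R})$; equivalently $\|N_t-N_\infty\|_{L^1(0,1)}\to0$ for some $N_\infty\in L^2(0,1)$. *)

theory Defs
  imports "HOL-Probability.Probability"
begin

definition unit_lebesgue :: "real measure" where
  "unit_lebesgue = restrict_space lborel {0<..<1}"

definition L2 :: "'a measure \<Rightarrow> ('a \<Rightarrow> real) set" where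
  "L2 M = {f \<in> borel_measurable M. integrable M (\<lambda>x. (f x)\<^sup>2)}"

definition L2_norm :: "'a measure \<Rightarrow> ('a \<Rightarrow> real) \<Rightarrow> real" where
  "L2_norm M f = sqrt (\<integral>x. (f x)\<^sup>2 \<partial>M)"

definition P2 :: "real measure set" where
  "P2 = {\<mu>. prob_space \<mu> \<and> sets \<mu> = sets borel \<and> integrable \<mu> (\<lambda>x. x\<^sup>2)}"

definition couplings :: "real measure \<Rightarrow> real measure \<Rightarrow> (real \<times> real) measure set" where
  "couplings \<mu> \<nu> = {\<gamma>. prob_space \<gamma> \<and> sets \<gamma> = sets (borel \<Otimes>\<^sub>M borel) \<and>
     distr \<gamma> borel fst = \<mu> \<and> distr \<gamma> borel snd = \<nu>}"

definition W1 :: "real measure \<Rightarrow> real measure \<Rightarrow> ennreal" where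
  "W1 \<mu> \<nu> = (INF \<gamma> \<in> couplings \<mu> \<nu>. \<integral>\<^sup>+ p. ennreal \<bar>fst p - snd p\<bar> \<partial>\<gamma>)"

definition right_continuous_01 :: "(real \<Rightarrow> real) \<Rightarrow> bool" where
  "right_continuous_01 g \<longleftrightarrow> (\<forall>x\<in>{0<..<1}. continuous (at_right x) g)"

text \<open>The optimal map is unique as a function on the open unit interval; the predicate leaves
  its values elsewhere unconstrained.\<close>

definition optimal_map :: "real measure \<Rightarrow> (real \<Rightarrow> real) \<Rightarrow> bool" where
  "optimal_map \<mu> N \<longleftrightarrow> mono_on {0<..<1} N \<and> right_continuous_01 N \<and>
     N \<in> borel_measurable unit_lebesgue \<and> distr unit_lebesgue borel N = \<mu>"

text \<open>Every almost-everywhere class in the cone has a representative that is nondecreasing on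
  all of the open unit interval, so the cone is given by such representatives.\<close>

definition mono_cone :: "(real \<Rightarrow> real) set" where
  "mono_cone = {g \<in> L2 unit_lebesgue. mono_on {0<..<1} g}"

text \<open>The orthogonal projection onto the closed convex cone is the nearest point in the
  \<open>L\<^sup>2\<close> distance. For square-integrable \<open>f\<close> its right-continuous representative is unique
  on the open unit interval, so the choice only concerns the irrelevant values outside it.\<close>

definition proj_mono_cone :: "(real \<Rightarrow> real) \<Rightarrow> (real \<Rightarrow> real)" where
  "proj_mono_cone f = (SOME g. g \<in> mono_cone \<and> right_continuous_01 g \<and>
     (\<forall>h\<in>mono_cone. L2_norm unit_lebesgue (\<lambda>x. f x - g x) \<le> L2_norm unit_lebesgue (\<lambda>x. f x - h x)))"

definition sticky_map :: "(real \<Rightarrow> real) \<Rightarrow> (real \<Rightarrow> real) \<Rightarrow> real \<Rightarrow> (real \<Rightarrow> real)" where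
  "sticky_map N0 V0 t = proj_mono_cone (\<lambda>x. N0 x + t * V0 x)"

definition sticky_density :: "(real \<Rightarrow> real) \<Rightarrow> (real \<Rightarrow> real) \<Rightarrow> real \<Rightarrow> real measure" where
  "sticky_density N0 V0 t = distr unit_lebesgue borel (sticky_map N0 V0 t)"

definition converges_to_equilibrium :: "(real \<Rightarrow> real measure) \<Rightarrow> bool" where
  "converges_to_equilibrium \<rho> \<longleftrightarrow>
     (\<exists>\<rho>_inf \<in> P2. ((\<lambda>t. W1 (\<rho> t) \<rho>_inf) \<longlongrightarrow> 0) at_top)"

end

theory Submission
  imports Defs
begin

text \<open>Write \<open>\<langle>f, g\<rangle>\<close> for the inner product of \<open>L\<^sup>2(0,1)\<close> and \<open>K\<close> for the cone of monotone functions. The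
  condition on \<open>V0\<close> in the theorem says exactly that \<open>V0\<close> lies in the polar cone of \<open>K\<close>, that is
  \<open>\<langle>V0, h\<rangle> \<le> 0\<close> for all \<open>h\<close> in \<open>K\<close>: the monotone functions \<open>1\<close>, \<open>-1\<close> and minus the indicators of
  initial intervals recover the condition, and conversely a layer-cake decomposition reduces a general
  monotone \<open>h\<close> to such functions (\<open>nonneg_primitive_in_polar_cone\<close>). With this reformulation the proof
  works with the projection alone and never computes convex envelopes.

  If \<open>V0\<close> is in the polar cone, then \<open>N\<^sub>t\<close>, the projection of \<open>N0 + t V0\<close>, minimizes
  \<open>\<parallel>h - N0\<parallel>\<^sup>2 - 2 t \<langle>V0, h\<rangle>\<close> over \<open>h\<close> in \<open>K\<close>. This is a penalty method: the penalty is nonnegative on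
  \<open>K\<close>, so the minimal values increase with \<open>t\<close> and remain below \<open>\<parallel>N0\<parallel>\<^sup>2\<close>. Strong convexity bounds the
  squared distance of two minimizers by the increment of the minimal values, so \<open>N\<^sub>t\<close> is Cauchy in
  \<open>L\<^sup>2(0,1)\<close> (\<open>sticky_map_converges_L2\<close>). Its limit \<open>v\<close> gives the equilibrium as the image of Lebesgue
  measure under \<open>v\<close>, because the pair \<open>(N\<^sub>t, v)\<close> is a coupling whose cost is the \<open>L\<^sup>1\<close> distance.

  Conversely, let the densities converge in \<open>W1\<close>. Then their first absolute moments, which are the
  \<open>L\<^sup>1\<close> norms of \<open>N\<^sub>t\<close>, are eventually bounded. For \<open>k\<close> in \<open>K\<close> with \<open>\<bar>k\<bar> \<le> 1\<close> the projection satisfies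
  \<open>\<langle>N0, k\<rangle> + t \<langle>V0, k\<rangle> \<le> \<langle>N\<^sub>t, k\<rangle> \<le> \<parallel>N\<^sub>t\<parallel>\<close> with the \<open>L\<^sup>1\<close> norm on the right, and letting \<open>t\<close> grow yields
  \<open>\<langle>V0, k\<rangle> \<le> 0\<close> (\<open>equilibrium_velocity_polar\<close>).\<close>

section \<open>Square-integrable functions\<close>

lemma L2I: "f \<in> borel_measurable M \<Longrightarrow> integrable M (\<lambda>x. (f x)\<^sup>2) \<Longrightarrow> f \<in> L2 M"
  by (simp add: L2_def)

lemma L2_measurable: "f \<in> L2 M \<Longrightarrow> f \<in> borel_measurable M"
  by (simp add: L2_def)

lemma L2_square_integrable: "f \<in> L2 M \<Longrightarrow> integrable M (\<lambda>x. (f x)\<^sup>2)"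
  by (simp add: L2_def)

lemma L2_mult_integrable:
  assumes "f \<in> L2 M" "g \<in> L2 M"
  shows "integrable M (\<lambda>x. f x * g x)"
proof (rule Bochner_Integration.integrable_bound)
  show "integrable M (\<lambda>x. (f x)\<^sup>2 + (g x)\<^sup>2)"
    using assms by (simp add: L2_def)
  have "\<bar>a * b\<bar> \<le> a\<^sup>2 + b\<^sup>2" for a b :: real
  proof -
    have "0 \<le> (\<bar>a\<bar> - \<bar>b\<bar>)\<^sup>2" by simp
    then have "2 * \<bar>a * b\<bar> \<le> a\<^sup>2 + b\<^sup>2"
      by (simp add: power2_eq_square algebra_simps abs_mult)
    then show ?thesis by linarith
  qed
  then show "AE x in M. norm (f x * g x) \<le> norm ((f x)\<^sup>2 + (g x)\<^sup>2)"
    by simp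
qed (use assms in \<open>auto simp: L2_def\<close>)

lemma L2_add:
  assumes "f \<in> L2 M" "g \<in> L2 M"
  shows "(\<lambda>x. f x + g x) \<in> L2 M"
  using assms L2_mult_integrable[OF assms]
  by (auto simp: L2_def power2_sum mult.assoc)

lemma L2_cmult:
  assumes "f \<in> L2 M"
  shows "(\<lambda>x. c * f x) \<in> L2 M"
  using assms by (auto simp: L2_def power_mult_distrib)

lemma L2_diff:
  assumes "f \<in> L2 M" "g \<in> L2 M"
  shows "(\<lambda>x. f x - g x) \<in> L2 M"
  using L2_add[OF assms(1) L2_cmult[OF assms(2), of "-1"]] by simp

lemma (in finite_measure) L2_integrable: "f \<in> L2 M \<Longrightarrow> integrable M f"
  by (rule square_integrable_imp_integrable[OF L2_measurable L2_square_integrable])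

lemma (in prob_space) integral_abs_le_L2:
  assumes "f \<in> L2 M"
  shows "(\<integral>x. \<bar>f x\<bar> \<partial>M) \<le> sqrt (\<integral>x. (f x)\<^sup>2 \<partial>M)"
proof -
  have "0 \<le> (\<integral>x. (f x)\<^sup>2 \<partial>M) - (\<integral>x. \<bar>f x\<bar> \<partial>M)\<^sup>2"
    using variance_positive[of "\<lambda>x. \<bar>f x\<bar>"] variance_eq[of "\<lambda>x. \<bar>f x\<bar>"]
      L2_integrable[OF assms] L2_square_integrable[OF assms] by simp
  then show ?thesis
    by (intro real_le_rsqrt) simp
qed

text \<open>Fatou's lemma is the lower semicontinuity that gives all \<open>L\<^sup>2\<close> limits below: it puts a pointwise limit
  into \<open>L\<^sup>2\<close>, turns a Cauchy condition into convergence, and shows that the limit of a minimizing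
  sequence is a minimizer.\<close>

lemma L2_Fatou:
  assumes w: "\<And>n. w n \<in> L2 M" and v[measurable]: "v \<in> borel_measurable M"
    and lim: "AE x in M. (\<lambda>n. w n x) \<longlonglongrightarrow> v x"
    and le: "\<And>n. (\<integral>x. (w n x)\<^sup>2 \<partial>M) \<le> c n" and c: "c \<longlonglongrightarrow> C"
  shows "v \<in> L2 M" "(\<integral>x. (v x)\<^sup>2 \<partial>M) \<le> C"
proof -
  have [measurable]: "w n \<in> borel_measurable M" for n
    using w by (rule L2_measurable)
  have "0 \<le> c n" for n
    by (rule order_trans[OF _ le]) simp
  then have "0 \<le> C"
    using c by (intro LIMSEQ_le_const) auto
  have "(\<integral>\<^sup>+x. ennreal ((v x)\<^sup>2) \<partial>M) = (\<integral>\<^sup>+x. liminf (\<lambda>n. ennreal ((w n x)\<^sup>2)) \<partial>M)"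
  proof (rule nn_integral_cong_AE)
    show "AE x in M. ennreal ((v x)\<^sup>2) = liminf (\<lambda>n. ennreal ((w n x)\<^sup>2))"
      using lim
    proof eventually_elim
      case (elim x)
      have "(\<lambda>n. ennreal ((w n x)\<^sup>2)) \<longlonglongrightarrow> ennreal ((v x)\<^sup>2)"
        by (rule tendsto_ennrealI[OF tendsto_power[OF elim]])
      then show ?case
        by (rule lim_imp_Liminf[OF sequentially_bot, symmetric])
    qed
  qed
  also have "\<dots> \<le> liminf (\<lambda>n. \<integral>\<^sup>+x. ennreal ((w n x)\<^sup>2) \<partial>M)"
    by (rule nn_integral_liminf) measurable
  also have "\<dots> \<le> liminf (\<lambda>n. ennreal (c n))"
  proof (rule Liminf_mono, rule always_eventually, rule allI)
    fix n
    show "(\<integral>\<^sup>+x. ennreal ((w n x)\<^sup>2) \<partial>M) \<le> ennreal (c n)"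
      using le[of n] L2_square_integrable[OF w[of n]]
      by (simp add: nn_integral_eq_integral ennreal_leI)
  qed
  also have "\<dots> = ennreal C"
    by (rule lim_imp_Liminf[OF sequentially_bot tendsto_ennrealI[OF c]])
  finally have bound: "(\<integral>\<^sup>+x. ennreal ((v x)\<^sup>2) \<partial>M) \<le> ennreal C" .
  have "(\<integral>\<^sup>+x. ennreal ((v x)\<^sup>2) \<partial>M) < \<infinity>"
    using le_less_trans[OF bound ennreal_less_top] by simp
  then have "integrable M (\<lambda>x. (v x)\<^sup>2)"
    by (intro integrableI_bounded) simp_all
  then show "v \<in> L2 M"
    by (intro L2I) auto
  then show "(\<integral>x. (v x)\<^sup>2 \<partial>M) \<le> C"
    using bound \<open>0 \<le> C\<close> L2_square_integrable[of v M] by (simp add: nn_integral_eq_integral)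
qed

text \<open>Riesz--Fischer. On a probability space a Cauchy sequence in \<open>L\<^sup>2\<close> is Cauchy in \<open>L\<^sup>1\<close>, so a
  subsequence converges almost everywhere, and Fatou's lemma upgrades its limit to a limit of the whole
  sequence in \<open>L\<^sup>2\<close>. The subsequence is part of the conclusion because monotonicity of a limit is only
  visible pointwise.\<close>

lemma (in prob_space) L2_complete:
  assumes u: "\<And>n. u n \<in> L2 M"
    and Cauchy: "\<And>e. 0 < e \<Longrightarrow> \<exists>N. \<forall>i\<ge>N. \<forall>j\<ge>N. (\<integral>x. (u i x - u j x)\<^sup>2 \<partial>M) \<le> e"
  obtains v r where "v \<in> L2 M" "strict_mono (r :: nat \<Rightarrow> nat)"
    "AE x in M. (\<lambda>n. u (r n) x) \<longlonglongrightarrow> v x"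
    "(\<lambda>n. \<integral>x. (u n x - v x)\<^sup>2 \<partial>M) \<longlonglongrightarrow> 0"
proof -
  have [measurable]: "u n \<in> borel_measurable M" for n
    using u by (rule L2_measurable)
  have L1: "\<exists>N. \<forall>i\<ge>N. \<forall>j\<ge>N. (\<integral>x. norm (u i x - u j x) \<partial>M) < e" if "0 < e" for e
  proof -
    obtain N where N: "\<And>i j. i \<ge> N \<Longrightarrow> j \<ge> N \<Longrightarrow> (\<integral>x. (u i x - u j x)\<^sup>2 \<partial>M) \<le> (e/2)\<^sup>2"
      using Cauchy[of "(e/2)\<^sup>2"] \<open>0 < e\<close> by auto
    have "(\<integral>x. norm (u i x - u j x) \<partial>M) < e" if "i \<ge> N" "j \<ge> N" for i j
    proof -
      have "(\<integral>x. norm (u i x - u j x) \<partial>M) \<le> sqrt (\<integral>x. (u i x - u j x)\<^sup>2 \<partial>M)"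
        using integral_abs_le_L2[OF L2_diff[OF u[of i] u[of j]]] by simp
      also have "\<dots> \<le> sqrt ((e/2)\<^sup>2)"
        using N[OF that] by (rule real_sqrt_le_mono)
      also have "\<dots> < e"
        using \<open>0 < e\<close> by simp
      finally show ?thesis .
    qed
    then show ?thesis by blast
  qed
  obtain r where r: "strict_mono (r :: nat \<Rightarrow> nat)" "AE x in M. Cauchy (\<lambda>i. u (r i) x)"
    using cauchy_L1_AE_cauchy_subseq[of M u] L2_integrable[OF u] L1 by blast
  define v where "v x = lim (\<lambda>i. u (r i) x)" for x
  have [measurable]: "v \<in> borel_measurable M"
    unfolding v_def by measurable
  have lim: "AE x in M. (\<lambda>n. u (r n) x) \<longlonglongrightarrow> v x"
    using r(2)
  proof eventually_elim
    case (elim x)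
    then show ?case
      by (simp add: v_def Cauchy_convergent_iff convergent_LIMSEQ_iff)
  qed
  have close: "\<exists>N. \<forall>n\<ge>N. (\<lambda>x. u n x - v x) \<in> L2 M \<and> (\<integral>x. (u n x - v x)\<^sup>2 \<partial>M) \<le> e" if e: "0 < e" for e
  proof -
    obtain N where N: "\<And>i j. i \<ge> N \<Longrightarrow> j \<ge> N \<Longrightarrow> (\<integral>x. (u i x - u j x)\<^sup>2 \<partial>M) \<le> e"
      using Cauchy[OF e] by blast
    have "(\<lambda>x. u n x - v x) \<in> L2 M \<and> (\<integral>x. (u n x - v x)\<^sup>2 \<partial>M) \<le> e" if "n \<ge> N" for n
    proof -
      have le: "(\<integral>x. (u n x - u (r (k + N)) x)\<^sup>2 \<partial>M) \<le> e" for k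
        using seq_suble[OF r(1), of "k + N"] by (intro N that) linarith
      have "AE x in M. (\<lambda>k. u n x - u (r (k + N)) x) \<longlonglongrightarrow> u n x - v x"
        using lim by eventually_elim (intro tendsto_intros LIMSEQ_ignore_initial_segment)
      from L2_Fatou[OF L2_diff[OF u u] _ this le tendsto_const] show ?thesis
        by simp
    qed
    then show ?thesis by blast
  qed
  obtain n where "(\<lambda>x. u n x - v x) \<in> L2 M"
    using close[of 1] by auto
  from L2_diff[OF u[of n] this] have "v \<in> L2 M"
    by simp
  moreover have "(\<lambda>n. \<integral>x. (u n x - v x)\<^sup>2 \<partial>M) \<longlonglongrightarrow> 0"
  proof (rule LIMSEQ_I)
    fix e :: real assume "0 < e"
    then obtain N where "\<forall>n\<ge>N. (\<integral>x. (u n x - v x)\<^sup>2 \<partial>M) \<le> e/2"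
      using close[of "e/2"] by auto
    then show "\<exists>N. \<forall>n\<ge>N. norm ((\<integral>x. (u n x - v x)\<^sup>2 \<partial>M) - 0) < e"
      using \<open>0 < e\<close> by (intro exI[of _ N]) (auto intro: le_less_trans)
  qed
  ultimately show ?thesis
    using that r(1) lim by blast
qed

lemma (in prob_space) L2_complete_at_top:
  fixes u :: "real \<Rightarrow> 'a \<Rightarrow> real"
  assumes u: "\<And>t. u t \<in> L2 M"
    and Cauchy: "\<And>e. 0 < e \<Longrightarrow> \<exists>T. \<forall>s\<ge>T. \<forall>t\<ge>T. (\<integral>x. (u s x - u t x)\<^sup>2 \<partial>M) \<le> e"
  obtains v where "v \<in> L2 M" "((\<lambda>t. \<integral>x. (u t x - v x)\<^sup>2 \<partial>M) \<longlongrightarrow> 0) at_top"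
proof -
  have "\<exists>N::nat. \<forall>i\<ge>N. \<forall>j\<ge>N. (\<integral>x. (u (real i) x - u (real j) x)\<^sup>2 \<partial>M) \<le> e" if e: "0 < e" for e
  proof -
    obtain T where T: "\<And>s t. s \<ge> T \<Longrightarrow> t \<ge> T \<Longrightarrow> (\<integral>x. (u s x - u t x)\<^sup>2 \<partial>M) \<le> e"
      using Cauchy[OF e] by blast
    have "\<forall>i\<ge>nat \<lceil>T\<rceil>. \<forall>j\<ge>nat \<lceil>T\<rceil>. (\<integral>x. (u (real i) x - u (real j) x)\<^sup>2 \<partial>M) \<le> e"
      by (auto intro!: T simp: nat_ceiling_le_eq)
    then show ?thesis by blast
  qed
  from L2_complete[of "\<lambda>n. u (real n)", OF u this]
  obtain v where v: "v \<in> L2 M" "(\<lambda>n. \<integral>x. (u (real n) x - v x)\<^sup>2 \<partial>M) \<longlonglongrightarrow> 0"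
    by blast
  have "((\<lambda>t. \<integral>x. (u t x - v x)\<^sup>2 \<partial>M) \<longlongrightarrow> 0) at_top"
  proof (rule tendstoI)
    fix e :: real assume "0 < e"
    obtain T where T: "\<And>s t. s \<ge> T \<Longrightarrow> t \<ge> T \<Longrightarrow> (\<integral>x. (u s x - u t x)\<^sup>2 \<partial>M) \<le> e/8"
      using Cauchy[of "e/8"] \<open>0 < e\<close> by auto
    \<comment> \<open>The limit along the integers is reached within \<open>e/8\<close> at some late integer time \<open>n\<close>, and by the
      Cauchy condition every later real time is within \<open>e/8\<close> of time \<open>n\<close>.\<close>
    have "\<forall>\<^sub>F n in sequentially. (\<integral>x. (u (real n) x - v x)\<^sup>2 \<partial>M) < e/8 \<and> T \<le> real n"
      using order_tendstoD(2)[OF v(2), of "e/8"] \<open>0 < e\<close> eventually_ge_at_top[of "nat \<lceil>T\<rceil>"]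
      by (auto simp: nat_ceiling_le_eq elim: eventually_elim2)
    then obtain n where n: "(\<integral>x. (u (real n) x - v x)\<^sup>2 \<partial>M) < e/8" "T \<le> real n"
      using eventually_happens'[OF sequentially_bot] by blast
    have "dist (\<integral>x. (u t x - v x)\<^sup>2 \<partial>M) 0 < e" if "t \<ge> T" for t
    proof -
      have i: "integrable M (\<lambda>x. (u t x - u (real n) x)\<^sup>2)" "integrable M (\<lambda>x. (u (real n) x - v x)\<^sup>2)"
        "integrable M (\<lambda>x. (u t x - v x)\<^sup>2)"
        by (intro L2_square_integrable L2_diff u v)+
      have "(\<integral>x. (u t x - v x)\<^sup>2 \<partial>M) \<le> (\<integral>x. 2 * (u t x - u (real n) x)\<^sup>2 + 2 * (u (real n) x - v x)\<^sup>2 \<partial>M)"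
      proof (rule integral_mono)
        fix x
        have "0 \<le> ((u t x - u (real n) x) - (u (real n) x - v x))\<^sup>2" by simp
        then show "(u t x - v x)\<^sup>2 \<le> 2 * (u t x - u (real n) x)\<^sup>2 + 2 * (u (real n) x - v x)\<^sup>2"
          by (simp add: power2_eq_square algebra_simps)
      qed (use i in auto)
      also have "\<dots> = 2 * (\<integral>x. (u t x - u (real n) x)\<^sup>2 \<partial>M) + 2 * (\<integral>x. (u (real n) x - v x)\<^sup>2 \<partial>M)"
        using i by simp
      also have "\<dots> < e"
        using T[OF that n(2)] n(1) \<open>0 < e\<close> by linarith
      finally show ?thesis by simp
    qed
    then show "\<forall>\<^sub>F t in at_top. dist (\<integral>x. (u t x - v x)\<^sup>2 \<partial>M) 0 < e"
      using eventually_ge_at_top[of T] by (rule eventually_mono[rotated])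
  qed
  with v(1) show ?thesis by (rule that)
qed

section \<open>The unit interval and its monotone functions\<close>

lemma space_unit_lebesgue [simp]: "space unit_lebesgue = {0<..<1}"
  by (simp add: unit_lebesgue_def space_restrict_space)

lemma prob_space_unit_lebesgue: "prob_space unit_lebesgue"
  unfolding unit_lebesgue_def
  by (rule prob_spaceI) (simp add: emeasure_restrict_space space_restrict_space)

interpretation U: prob_space unit_lebesgue
  by (rule prob_space_unit_lebesgue)

lemma AE_unit_lebesgue: "(AE x in unit_lebesgue. P x) \<longleftrightarrow> (AE x in lborel. 0 < x \<and> x < 1 \<longrightarrow> P x)"
  unfolding unit_lebesgue_def by (subst AE_restrict_space_iff) auto

lemma AE_unit_lebesgue_notin_countable: "countable C \<Longrightarrow> AE x in unit_lebesgue. x \<notin> C"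
  unfolding AE_unit_lebesgue
  by (rule AE_mp[OF AE_not_in[OF countable_imp_null_set_lborel]]) auto

lemma AE_unit_lebesgue_dense:
  assumes ae: "AE x in unit_lebesgue. P x" and ab: "0 \<le> a" "a < b" "b \<le> 1"
  shows "\<exists>x. a < x \<and> x < b \<and> P x"
proof (rule ccontr)
  assume no: "\<nexists>x. a < x \<and> x < b \<and> P x"
  have "AE x in lborel. x \<notin> {a<..<b}"
    using ae unfolding AE_unit_lebesgue by eventually_elim (use no ab in fastforce)
  then have "{a<..<b} \<in> null_sets lborel"
    by (simp add: AE_iff_null_sets)
  then show False
    using ab by (simp add: null_sets_def)
qed

lemma mono_on_measurable_unit_lebesgue:
  fixes g :: "real \<Rightarrow> real"
  assumes "mono_on {0<..<1} g"
  shows "g \<in> borel_measurable unit_lebesgue"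
proof -
  have "sets unit_lebesgue = sets (restrict_space borel {0<..<1})"
    unfolding unit_lebesgue_def by (rule sets_restrict_space_cong) simp
  then show ?thesis
    using borel_measurable_mono_on_fnc[OF assms] measurable_cong_sets by blast
qed

text \<open>An almost everywhere limit of monotone functions is monotone only on a set of full measure. That set is
  dense, so taking infima over its points to the right of \<open>x\<close> defines a right-continuous monotone function
  everywhere. At a point \<open>x\<close> of \<open>E\<close> this function is at least \<open>u x\<close>, while at every point to the left of \<open>x\<close>
  it is at most \<open>u x\<close>; hence the two agree at \<open>x\<close> if the new function is continuous there, which fails
  at countably many points only.\<close>

lemma right_continuous_monotone_representative:
  fixes u :: "real \<Rightarrow> real"
  assumes ae: "AE x in unit_lebesgue. x \<in> E" and E: "E \<subseteq> {0<..<1}" and mono: "mono_on E u"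
  obtains G where "mono_on {0<..<1} G" "right_continuous_01 G" "AE x in unit_lebesgue. G x = u x"
proof -
  define G where "G x = Inf (u ` (E \<inter> {x<..<1}))" for x
  have ne: "E \<inter> {x<..<1} \<noteq> {}" if "0 < x" "x < 1" for x
    using AE_unit_lebesgue_dense[OF ae, of x 1] that by auto
  have below: "\<exists>e\<in>E. e < x" if "0 < x" "x < 1" for x
    using AE_unit_lebesgue_dense[OF ae, of 0 x] that by auto
  have bdd: "bdd_below (u ` (E \<inter> {x<..<1}))" if "0 < x" "x < 1" for x
  proof -
    obtain e where "e \<in> E" "e < x" using below \<open>0 < x\<close> \<open>x < 1\<close> by blast
    then show ?thesis
      by (intro bdd_belowI2[of _ "u e"] mono_onD[OF mono]) auto
  qed
  have upper: "G x \<le> u e" if "0 < x" "x < e" "e \<in> E" for x e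
    unfolding G_def using that E by (intro cInf_lower bdd imageI) auto
  have lower: "u e \<le> G x" if "e \<in> E" "e \<le> x" "x < 1" for x e
    unfolding G_def using that E ne[of x]
    by (intro cInf_greatest) (auto intro!: mono_onD[OF mono] ne)
  have mono_G: "mono_on {0<..<1} G"
    unfolding G_def by (rule mono_onI, rule cInf_superset_mono) (use ne bdd in auto)
  have "right_continuous_01 G"
    unfolding right_continuous_01_def continuous_within
  proof (intro ballI order_tendstoI)
    fix x a assume x: "x \<in> {0<..<1}" and "a < G x"
    then have "a < G y" if "x < y" "y < 1" for y
      using mono_onD[OF mono_G, of x y] that by auto
    then show "\<forall>\<^sub>F y in at_right x. a < G y"
      using x by (auto simp: eventually_at_right_field)
  next
    fix x a assume x: "x \<in> {0<..<1}" and a: "G x < a"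
    then obtain e where e: "e \<in> E" "x < e" "u e < a"
      unfolding G_def using cInf_lessD[of "u ` (E \<inter> {x<..<1})" a] ne[of x] by auto
    have "G y < a" if "x < y" "y < e" for y
      using upper[of y e] x e that by auto
    then show "\<forall>\<^sub>F y in at_right x. G y < a"
      using e by (auto simp: eventually_at_right_field)
  qed
  moreover have "AE x in unit_lebesgue. G x = u x"
    using ae AE_unit_lebesgue_notin_countable[OF mono_on_ctble_discont_open[OF open_greaterThanLessThan mono_G]]
  proof eventually_elim
    case (elim x)
    then have x: "0 < x" "x < 1" "isCont G x" using E by auto
    have "G x \<le> u x"
    proof (rule ccontr)
      assume "\<not> G x \<le> u x"
      then have "\<forall>\<^sub>F y in at x. u x < G y"
        using x(3) by (intro order_tendstoD) (auto simp: isCont_def)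
      then have "\<forall>\<^sub>F y in at_left x. u x < G y"
        by (simp add: eventually_at_split)
      moreover have "\<forall>\<^sub>F y in at_left x. 0 < y \<and> y < x"
        using x unfolding eventually_at_left_field by (intro exI[of _ 0]) auto
      ultimately have "\<forall>\<^sub>F y in at_left x. False"
        by eventually_elim (use upper[of _ x] elim(1) in force)
      then show False by simp
    qed
    moreover have "u x \<le> G x" using lower elim(1) x by auto
    ultimately show ?case by simp
  qed
  ultimately show ?thesis using that mono_G by blast
qed

section \<open>Projection onto the cone of monotone functions\<close>

lemma mono_coneD:
  assumes "g \<in> mono_cone"
  shows mono_cone_L2: "g \<in> L2 unit_lebesgue" and mono_cone_mono: "mono_on {0<..<1} g"
  using assms by (auto simp: mono_cone_def)

lemma mono_cone_combination:
  assumes "g \<in> mono_cone" "h \<in> mono_cone" "0 \<le> a" "0 \<le> b"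
  shows "(\<lambda>x. a * g x + b * h x) \<in> mono_cone"
  using assms unfolding mono_cone_def
  by (auto intro!: L2_add L2_cmult mono_onI add_mono mult_left_mono dest: mono_onD)

lemma bounded_mono_in_mono_cone:
  assumes "mono_on {0<..<1} k" "\<And>x. \<bar>k x\<bar> \<le> B"
  shows "k \<in> mono_cone"
proof -
  have [measurable]: "k \<in> borel_measurable unit_lebesgue"
    using assms(1) by (rule mono_on_measurable_unit_lebesgue)
  have "(k x)\<^sup>2 \<le> B\<^sup>2" for x
    using power_mono[OF assms(2)[of x], of 2] by simp
  then have "integrable unit_lebesgue (\<lambda>x. (k x)\<^sup>2)"
    by (intro U.integrable_const_bound[of _ "B\<^sup>2"]) auto
  then show ?thesis
    using assms(1) by (simp add: mono_cone_def L2_def)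
qed

lemma L2_parallelogram:
  assumes f: "f \<in> L2 M" "g \<in> L2 M" "h \<in> L2 M"
  shows "(\<integral>x. (f x - (g x + h x) / 2)\<^sup>2 \<partial>M)
    = (\<integral>x. (f x - g x)\<^sup>2 \<partial>M) / 2 + (\<integral>x. (f x - h x)\<^sup>2 \<partial>M) / 2 - (\<integral>x. (g x - h x)\<^sup>2 \<partial>M) / 4"
proof -
  have i: "integrable M (\<lambda>x. (f x - g x)\<^sup>2)" "integrable M (\<lambda>x. (f x - h x)\<^sup>2)"
    "integrable M (\<lambda>x. (g x - h x)\<^sup>2)"
    by (intro L2_square_integrable L2_diff assms)+
  have "(\<lambda>x. (f x - (g x + h x) / 2)\<^sup>2)
      = (\<lambda>x. (f x - g x)\<^sup>2 / 2 + (f x - h x)\<^sup>2 / 2 - (g x - h x)\<^sup>2 / 4)"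
    by (rule ext) (simp add: power2_eq_square field_simps)
  then show ?thesis
    using i by simp
qed

lemma mono_cone_midpoint:
  assumes "g \<in> mono_cone" "h \<in> mono_cone"
  shows "(\<lambda>x. (g x + h x) / 2) \<in> mono_cone"
  using mono_cone_combination[OF assms, of "1/2" "1/2"] by (simp add: add_divide_distrib)

text \<open>The direct method: by the parallelogram identity and convexity of the cone a minimizing sequence is
  Cauchy, and its limit has a right-continuous monotone representative. The existence is what makes the
  choice operator in \<^const>\<open>proj_mono_cone\<close> meaningful.\<close>

lemma mono_cone_nearest_point_exists:
  assumes f: "f \<in> L2 unit_lebesgue"
  shows "\<exists>g. g \<in> mono_cone \<and> right_continuous_01 g \<and>
    (\<forall>h\<in>mono_cone. (\<integral>x. (f x - g x)\<^sup>2 \<partial>unit_lebesgue) \<le> (\<integral>x. (f x - h x)\<^sup>2 \<partial>unit_lebesgue))"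
proof -
  let ?D = "\<lambda>h. \<integral>x. (f x - h x)\<^sup>2 \<partial>unit_lebesgue"
  define d where "d = (INF h\<in>mono_cone. ?D h)"
  have ne: "mono_cone \<noteq> {}"
    using bounded_mono_in_mono_cone[of "\<lambda>_. 0" 0] by (auto simp: mono_on_def)
  have bdd: "bdd_below (?D ` mono_cone)"
    by (intro bdd_belowI2[of _ 0]) simp
  have d_le: "d \<le> ?D h" if "h \<in> mono_cone" for h
    unfolding d_def using bdd that by (rule cINF_lower)
  have "\<exists>h\<in>mono_cone. ?D h \<le> d + 1 / real (Suc n)" for n
  proof -
    have "Inf (?D ` mono_cone) < d + 1 / real (Suc n)" unfolding d_def by simp
    from cInf_lessD[OF _ this] ne show ?thesis by (auto intro: less_imp_le)
  qed
  then obtain u where u: "\<And>n. u n \<in> mono_cone" "\<And>n. ?D (u n) \<le> d + 1 / real (Suc n)"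
    by metis
  have "\<exists>N. \<forall>i\<ge>N. \<forall>j\<ge>N. (\<integral>x. (u i x - u j x)\<^sup>2 \<partial>unit_lebesgue) \<le> e" if e: "0 < e" for e
  proof -
    obtain N where N: "1 / real (Suc N) < e / 4"
      using reals_Archimedean[of "e/4"] e by (auto simp: inverse_eq_divide)
    have "(\<integral>x. (u i x - u j x)\<^sup>2 \<partial>unit_lebesgue) \<le> e" if "i \<ge> N" "j \<ge> N" for i j
    proof -
      have "1 / real (Suc i) \<le> 1 / real (Suc N)" "1 / real (Suc j) \<le> 1 / real (Suc N)"
        using that by (auto intro!: divide_left_mono)
      then show ?thesis
        using d_le[OF mono_cone_midpoint[OF u(1)[of i] u(1)[of j]]] N u(2)[of i] u(2)[of j]
          L2_parallelogram[OF f mono_cone_L2[OF u(1)[of i]] mono_cone_L2[OF u(1)[of j]]]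
        by linarith
    qed
    then show ?thesis by blast
  qed
  from U.L2_complete[OF mono_cone_L2[OF u(1)] this]
  obtain v r where v: "v \<in> L2 unit_lebesgue" "strict_mono (r :: nat \<Rightarrow> nat)"
    and lim: "AE x in unit_lebesgue. (\<lambda>n. u (r n) x) \<longlonglongrightarrow> v x"
    by blast
  define E where "E = {x\<in>{0<..<1}. (\<lambda>n. u (r n) x) \<longlonglongrightarrow> v x}"
  have aeE: "AE x in unit_lebesgue. x \<in> E"
    using lim AE_space[of unit_lebesgue] by eventually_elim (simp add: E_def)
  have "mono_on E v"
  proof (rule mono_onI)
    fix x y assume xy: "x \<in> E" "y \<in> E" "x \<le> y"
    show "v x \<le> v y"
    proof (rule LIMSEQ_le)
      show "(\<lambda>n. u (r n) x) \<longlonglongrightarrow> v x" "(\<lambda>n. u (r n) y) \<longlonglongrightarrow> v y"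
        using xy by (auto simp: E_def)
      show "\<exists>N. \<forall>n\<ge>N. u (r n) x \<le> u (r n) y"
        using xy mono_onD[OF mono_cone_mono[OF u(1)]] by (auto simp: E_def)
    qed
  qed
  then obtain G where G: "mono_on {0<..<1} G" "right_continuous_01 G" "AE x in unit_lebesgue. G x = v x"
    using right_continuous_monotone_representative[OF aeE, of v] unfolding E_def by blast
  have [measurable]: "G \<in> borel_measurable unit_lebesgue" "v \<in> borel_measurable unit_lebesgue"
    "f \<in> borel_measurable unit_lebesgue"
    using mono_on_measurable_unit_lebesgue[OF G(1)] L2_measurable[OF v(1)] L2_measurable[OF f] by auto
  have "integrable unit_lebesgue (\<lambda>x. (G x)\<^sup>2) \<longleftrightarrow> integrable unit_lebesgue (\<lambda>x. (v x)\<^sup>2)"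
    by (rule integrable_cong_AE) (use G(3) in auto)
  then have "G \<in> mono_cone"
    using v(1) G(1) by (simp add: mono_cone_def L2_def)
  moreover have "?D G \<le> d"
  proof -
    have "?D G = ?D v"
      by (rule integral_cong_AE) (use G(3) in auto)
    also have "\<dots> \<le> d"
    proof (rule L2_Fatou(2))
      show "(\<lambda>x. f x - u (r n) x) \<in> L2 unit_lebesgue" for n
        by (intro L2_diff f mono_cone_L2 u)
      show "AE x in unit_lebesgue. (\<lambda>n. f x - u (r n) x) \<longlonglongrightarrow> f x - v x"
        using lim by eventually_elim (intro tendsto_intros)
      show "?D (u (r n)) \<le> d + 1 / real (Suc (r n))" for n
        by (rule u)
      have "(\<lambda>n. d + 1 / real (Suc n)) \<longlonglongrightarrow> d + 0"
        by (intro tendsto_add tendsto_const LIMSEQ_Suc[OF lim_1_over_n])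
      from LIMSEQ_subseq_LIMSEQ[OF this v(2)]
      show "(\<lambda>n. d + 1 / real (Suc (r n))) \<longlonglongrightarrow> d"
        by (simp add: o_def)
    qed measurable
    finally show ?thesis .
  qed
  ultimately show ?thesis
    using G(2) d_le by (meson order_trans)
qed

lemma
  assumes f: "f \<in> L2 unit_lebesgue"
  shows proj_mono_cone_in: "proj_mono_cone f \<in> mono_cone"
    and proj_mono_cone_nearest: "\<And>h. h \<in> mono_cone \<Longrightarrow>
      (\<integral>x. (f x - proj_mono_cone f x)\<^sup>2 \<partial>unit_lebesgue) \<le> (\<integral>x. (f x - h x)\<^sup>2 \<partial>unit_lebesgue)"
proof -
  have "\<exists>g. g \<in> mono_cone \<and> right_continuous_01 g \<and>
     (\<forall>h\<in>mono_cone. L2_norm unit_lebesgue (\<lambda>x. f x - g x) \<le> L2_norm unit_lebesgue (\<lambda>x. f x - h x))"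
    using mono_cone_nearest_point_exists[OF f] by (simp add: L2_norm_def)
  from someI_ex[OF this] show "proj_mono_cone f \<in> mono_cone"
    "\<And>h. h \<in> mono_cone \<Longrightarrow>
      (\<integral>x. (f x - proj_mono_cone f x)\<^sup>2 \<partial>unit_lebesgue) \<le> (\<integral>x. (f x - h x)\<^sup>2 \<partial>unit_lebesgue)"
    unfolding proj_mono_cone_def[symmetric] by (auto simp: L2_norm_def)
qed

text \<open>Comparing the nearest point with its midpoint to \<open>h\<close> shows that the distance to \<open>f\<close> grows quadratically
  away from the nearest point. This quantitative uniqueness drives the convergence argument.\<close>

lemma proj_mono_cone_gap:
  assumes f: "f \<in> L2 unit_lebesgue" and h: "h \<in> mono_cone"
  shows "(\<integral>x. (f x - proj_mono_cone f x)\<^sup>2 \<partial>unit_lebesgue)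
      + (\<integral>x. (proj_mono_cone f x - h x)\<^sup>2 \<partial>unit_lebesgue) / 2
    \<le> (\<integral>x. (f x - h x)\<^sup>2 \<partial>unit_lebesgue)"
  using proj_mono_cone_nearest[OF f mono_cone_midpoint[OF proj_mono_cone_in[OF f] h]]
    L2_parallelogram[OF f mono_cone_L2[OF proj_mono_cone_in[OF f]] mono_cone_L2[OF h]]
  by linarith

lemma L2_square_diff:
  assumes "f \<in> L2 M" "g \<in> L2 M"
  shows "(\<integral>x. (f x - g x)\<^sup>2 \<partial>M)
    = (\<integral>x. (f x)\<^sup>2 \<partial>M) - 2 * (\<integral>x. f x * g x \<partial>M) + (\<integral>x. (g x)\<^sup>2 \<partial>M)"
proof -
  have "(\<lambda>x. (f x - g x)\<^sup>2) = (\<lambda>x. (f x)\<^sup>2 - 2 * (f x * g x) + (g x)\<^sup>2)"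
    by (rule ext) (simp add: power2_eq_square algebra_simps)
  then show ?thesis
    using L2_square_integrable[OF assms(1)] L2_square_integrable[OF assms(2)] L2_mult_integrable[OF assms]
    by simp
qed

text \<open>First variation of the distance: the cone contains \<open>g + e k\<close> for its nearest point \<open>g\<close> and each \<open>e > 0\<close>,
  so the derivative of the squared distance in direction \<open>k\<close> cannot be negative.\<close>

lemma proj_mono_cone_obtuse:
  assumes f: "f \<in> L2 unit_lebesgue" and k: "k \<in> mono_cone"
  shows "(\<integral>x. f x * k x \<partial>unit_lebesgue) \<le> (\<integral>x. proj_mono_cone f x * k x \<partial>unit_lebesgue)"
proof -
  let ?g = "proj_mono_cone f"
  let ?w = "\<lambda>x. f x - ?g x"
  define a where "a = (\<integral>x. ?w x * k x \<partial>unit_lebesgue)"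
  define b where "b = (\<integral>x. (k x)\<^sup>2 \<partial>unit_lebesgue)"
  have g: "?g \<in> mono_cone" by (rule proj_mono_cone_in[OF f])
  have w: "?w \<in> L2 unit_lebesgue" by (intro L2_diff f mono_cone_L2 g)
  have le: "2 * a \<le> e * b" if e: "0 < e" for e
  proof -
    have "(\<integral>x. (?w x)\<^sup>2 \<partial>unit_lebesgue) \<le> (\<integral>x. (f x - (1 * ?g x + e * k x))\<^sup>2 \<partial>unit_lebesgue)"
      by (intro proj_mono_cone_nearest[OF f] mono_cone_combination g k) (use e in auto)
    also have "\<dots> = (\<integral>x. (?w x - e * k x)\<^sup>2 \<partial>unit_lebesgue)"
      by (simp add: algebra_simps)
    also have "\<dots> = (\<integral>x. (?w x)\<^sup>2 \<partial>unit_lebesgue) - 2 * (e * a) + e * e * b"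
      using L2_square_diff[OF w L2_cmult[OF mono_cone_L2[OF k], of e]]
      by (simp add: a_def b_def power_mult_distrib power2_eq_square[of e] mult.left_commute[of _ e])
    finally have "0 \<le> e * (e * b - 2 * a)"
      by (simp add: algebra_simps)
    then show ?thesis
      using e by (simp add: zero_le_mult_iff)
  qed
  have "a \<le> 0"
  proof (rule ccontr)
    assume "\<not> a \<le> 0"
    then have "0 < a" by simp
    have "0 \<le> b" by (simp add: b_def)
    \<comment> \<open>The step \<open>e = a / (b + 1)\<close> makes the quadratic term smaller than the linear one.\<close>
    have "2 * a \<le> a / (b + 1) * b"
      using \<open>0 < a\<close> \<open>0 \<le> b\<close> by (intro le) auto
    also have "\<dots> \<le> a * 1"
      using \<open>0 < a\<close> \<open>0 \<le> b\<close> by (simp add: field_simps)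
    finally show False
      using \<open>0 < a\<close> by simp
  qed
  moreover have "a = (\<integral>x. f x * k x \<partial>unit_lebesgue) - (\<integral>x. ?g x * k x \<partial>unit_lebesgue)"
    unfolding a_def left_diff_distrib
    by (intro Bochner_Integration.integral_diff L2_mult_integrable f mono_cone_L2 g k)
  ultimately show ?thesis by simp
qed

section \<open>The polar of the cone\<close>

lemma integral_unit_lebesgue:
  "(\<integral>x. f x \<partial>unit_lebesgue) = (LBINT x:{0<..<1}. f x)" for f :: "real \<Rightarrow> real"
  unfolding unit_lebesgue_def set_lebesgue_integral_def by (subst integral_restrict_space) auto

lemma integral_unit_lebesgue_initial:
  fixes V :: "real \<Rightarrow> real"
  assumes "x \<le> 1"
  shows "(\<integral>w. indicator {0<..<x} w * V w \<partial>unit_lebesgue) = (LBINT w:{0<..<x}. V w)"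
  unfolding integral_unit_lebesgue set_lebesgue_integral_def
  by (rule Bochner_Integration.integral_cong) (use assms in \<open>auto simp: indicator_def\<close>)

text \<open>A down-closed set is an initial interval up to its right end point, so its integral is a value of the
  primitive of \<open>V\<close>, namely at \<open>Sup L\<close>, where the value \<open>1\<close> is covered by the condition on the total
  integral.\<close>

lemma integral_downset_nonneg:
  fixes V :: "real \<Rightarrow> real"
  assumes V: "V \<in> borel_measurable unit_lebesgue"
    and total: "(LBINT w:{0<..<1}. V w) = 0"
    and init: "\<forall>x\<in>{0<..<1}. (LBINT w:{0<..<x}. V w) \<ge> 0"
    and down: "\<And>x y. y \<in> L \<Longrightarrow> 0 < x \<Longrightarrow> x \<le> y \<Longrightarrow> x \<in> L"
    and sets: "L \<in> sets unit_lebesgue"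
  shows "0 \<le> (\<integral>w. indicator L w * V w \<partial>unit_lebesgue)"
proof (cases "L = {}")
  case False
  define a where "a = Sup L"
  have L01: "L \<subseteq> {0<..<1}" using sets.sets_into_space[OF sets] by simp
  have bdd: "bdd_above L" using L01 by (intro bdd_aboveI[of _ 1]) auto
  obtain z where z: "z \<in> L" using False by blast
  have "0 < a" using z L01 cSup_upper[OF z bdd] unfolding a_def by force
  have "a \<le> 1" unfolding a_def using False L01 by (intro cSup_least) auto
  have in_L: "w \<in> L" if w: "0 < w" "w < a" for w
  proof -
    obtain y where "y \<in> L" "w < y" using w(2) less_cSupD[OF False] unfolding a_def by blast
    then show ?thesis using down[of y w] w by simp
  qed
  have le_a: "w \<le> a" if "w \<in> L" for w
    using cSup_upper[OF that bdd] by (simp add: a_def)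
  have "(\<integral>w. indicator L w * V w \<partial>unit_lebesgue) = (\<integral>w. indicator {0<..<a} w * V w \<partial>unit_lebesgue)"
  proof (rule integral_cong_AE)
    have "{0<..<a} \<in> sets unit_lebesgue"
      unfolding unit_lebesgue_def using \<open>a \<le> 1\<close> by (subst sets_restrict_space_iff) auto
    then show "(\<lambda>w. indicator L w * V w) \<in> borel_measurable unit_lebesgue"
      "(\<lambda>w. indicator {0<..<a} w * V w) \<in> borel_measurable unit_lebesgue"
      using V sets by (auto intro!: borel_measurable_times borel_measurable_indicator)
    show "AE w in unit_lebesgue. indicator L w * V w = indicator {0<..<a} w * V w"
      using AE_unit_lebesgue_notin_countable[OF countable_finite[of "{a}", OF finite.insertI[OF finite.emptyI]]]
        AE_space[of unit_lebesgue]
    proof eventually_elim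
      case (elim w)
      then have "w \<in> L \<longleftrightarrow> w \<in> {0<..<a}" using in_L[of w] le_a[of w] by force
      then show ?case by (simp add: indicator_def)
    qed
  qed
  also have "\<dots> = (LBINT w:{0<..<a}. V w)"
    by (rule integral_unit_lebesgue_initial[OF \<open>a \<le> 1\<close>])
  also have "\<dots> \<ge> 0"
    using total init \<open>0 < a\<close> \<open>a \<le> 1\<close> by (cases "a = 1") auto
  finally show ?thesis .
qed simp

text \<open>The kernel of the layer-cake formula for a real number of either sign.\<close>

lemma layer_cake_signed:
  fixes c :: real
  defines "\<phi> \<equiv> \<lambda>s. indicator {0..<c} s - indicator {c..<0} s"
  shows "integrable lborel \<phi>" "(\<integral>s. \<phi> s \<partial>lborel) = c" "(\<integral>s. norm (\<phi> s) \<partial>lborel) = \<bar>c\<bar>"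
proof -
  have i: "integrable lborel (indicator {a..<b} :: real \<Rightarrow> real)"
      "(\<integral>s. indicator {a..<b} s \<partial>lborel) = max 0 (b - a)" for a b :: real
    by (cases "a \<le> b"; simp)+
  show "integrable lborel \<phi>"
    unfolding \<phi>_def by (intro Bochner_Integration.integrable_diff i)
  show "(\<integral>s. \<phi> s \<partial>lborel) = c"
    unfolding \<phi>_def by (simp only: Bochner_Integration.integral_diff[OF i(1) i(1)] i(2))
  have "(\<lambda>s. norm (\<phi> s)) = (\<lambda>s. indicator {0..<c} s + indicator {c..<0} s)"
    by (auto simp: \<phi>_def fun_eq_iff indicator_def)
  then show "(\<integral>s. norm (\<phi> s) \<partial>lborel) = \<bar>c\<bar>"
    by (simp only: Bochner_Integration.integral_add[OF i(1) i(1)] i(2))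
qed

text \<open>Writing \<open>h x\<close> as the integral over levels \<open>s\<close> of the signed layer-cake kernel and exchanging the
  integrals, the pairing of \<open>V\<close> with \<open>h\<close> becomes an integral over \<open>s\<close> of the integrals of \<open>V\<close> over superlevel sets of
  \<open>h\<close> (for \<open>s \<ge> 0\<close>) and negated integrals over sublevel sets (for \<open>s < 0\<close>). As the total integral of
  \<open>V\<close> vanishes, both equal minus the integral over the sublevel set, which is down-closed.\<close>

lemma nonneg_primitive_in_polar_cone:
  assumes V: "V \<in> L2 unit_lebesgue" and h: "h \<in> mono_cone"
    and total: "(LBINT w:{0<..<1}. V w) = 0"
    and init: "\<forall>x\<in>{0<..<1}. (LBINT w:{0<..<x}. V w) \<ge> 0"
  shows "(\<integral>x. V x * h x \<partial>unit_lebesgue) \<le> 0"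
proof -
  interpret pair_sigma_finite unit_lebesgue lborel
    by unfold_locales
  have [measurable]: "V \<in> borel_measurable unit_lebesgue" "h \<in> borel_measurable unit_lebesgue"
    using L2_measurable[OF V] L2_measurable[OF mono_cone_L2[OF h]] by auto
  have V_int: "integrable unit_lebesgue V"
    by (rule U.L2_integrable[OF V])
  have V0: "(\<integral>x. V x \<partial>unit_lebesgue) = 0"
    using total by (simp add: integral_unit_lebesgue)
  define \<phi> :: "real \<Rightarrow> real \<Rightarrow> real" where "\<phi> c s = indicator {0..<c} s - indicator {c..<0} s" for c s
  have \<phi>: "integrable lborel (\<phi> c)" "(\<integral>s. \<phi> c s \<partial>lborel) = c" "(\<integral>s. norm (\<phi> c s) \<partial>lborel) = \<bar>c\<bar>" for c
    unfolding \<phi>_def[abs_def] by (rule layer_cake_signed)+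
  have \<phi>_if: "\<phi> c s = (if 0 \<le> s \<and> s < c then 1 else 0) - (if c \<le> s \<and> s < 0 then 1 else 0)" for c s
    by (auto simp: \<phi>_def)
  have "integrable (unit_lebesgue \<Otimes>\<^sub>M lborel) (\<lambda>(x, s). V x * \<phi> (h x) s)"
  proof (rule Fubini_integrable)
    show "(\<lambda>(x, s). V x * \<phi> (h x) s) \<in> borel_measurable (unit_lebesgue \<Otimes>\<^sub>M lborel)"
      unfolding \<phi>_if by measurable
    have "integrable unit_lebesgue (\<lambda>x. norm (V x * h x))"
      by (intro integrable_norm L2_mult_integrable V mono_cone_L2 h)
    then show "integrable unit_lebesgue (\<lambda>x. \<integral>s. norm (case (x, s) of (x, s) \<Rightarrow> V x * \<phi> (h x) s) \<partial>lborel)"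
      using \<phi>(3) by (simp add: abs_mult)
    show "AE x in unit_lebesgue. integrable lborel (\<lambda>s. case (x, s) of (x, s) \<Rightarrow> V x * \<phi> (h x) s)"
      using \<phi>(1) by simp
  qed
  then have "(\<integral>s. (\<integral>x. V x * \<phi> (h x) s \<partial>unit_lebesgue) \<partial>lborel)
      = (\<integral>x. (\<integral>s. V x * \<phi> (h x) s \<partial>lborel) \<partial>unit_lebesgue)"
    by (rule Fubini_integral)
  also have "\<dots> = (\<integral>x. V x * h x \<partial>unit_lebesgue)"
    using \<phi>(2) by simp
  finally have eq: "(\<integral>x. V x * h x \<partial>unit_lebesgue)
      = (\<integral>s. (\<integral>x. V x * \<phi> (h x) s \<partial>unit_lebesgue) \<partial>lborel)" ..
  have "(\<integral>x. V x * \<phi> (h x) s \<partial>unit_lebesgue) \<le> 0" for s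
  proof -
    define L where "L = {x \<in> space unit_lebesgue. h x \<le> s}"
    have sets_L: "L \<in> sets unit_lebesgue"
      unfolding L_def by measurable
    have "0 \<le> (\<integral>w. indicator L w * V w \<partial>unit_lebesgue)"
    proof (rule integral_downset_nonneg[OF _ total init _ sets_L])
      fix x y assume "y \<in> L" "0 < x" "x \<le> y"
      then show "x \<in> L"
        using mono_onD[OF mono_cone_mono[OF h], of x y] by (auto simp: L_def)
    qed measurable
    moreover have "integrable unit_lebesgue (\<lambda>w. indicator L w * V w)"
      using integrable_mult_indicator[OF sets_L V_int] by simp
    moreover have "(\<integral>x. V x * \<phi> (h x) s \<partial>unit_lebesgue)
        = (\<integral>x. (if 0 \<le> s then V x else 0) - indicator L x * V x \<partial>unit_lebesgue)"
      by (rule Bochner_Integration.integral_cong) (auto simp: \<phi>_if L_def indicator_def)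
    ultimately show ?thesis
      using V_int V0 by (cases "0 \<le> s") simp_all
  qed
  then have "0 \<le> (\<integral>s. - (\<integral>x. V x * \<phi> (h x) s \<partial>unit_lebesgue) \<partial>lborel)"
    by (intro Bochner_Integration.integral_nonneg) simp
  then show ?thesis
    unfolding eq by simp
qed

section \<open>Strong convergence of the projected trajectory\<close>

text \<open>The positions at time \<open>t\<close> solve a penalized problem. Up to a constant that does not depend on \<open>h\<close>, the
  squared distance of \<open>h\<close> to \<open>N + t V\<close> is
  \<open>F t h = \<parallel>N - h\<parallel>\<^sup>2 - 2 t \<langle>V, h\<rangle>\<close>, and under the hypothesis the second term is a penalty that grows
  with \<open>t\<close>. Hence the minimal values \<open>m t\<close> increase; they are bounded by \<open>F t 0 = \<parallel>N\<parallel>\<^sup>2\<close>. By the quadratic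
  gap at the minimizer, the squared distance between the minimizers at times \<open>s \<le> t\<close> is at most twice the
  increment \<open>m t - m s\<close>, so the trajectory is Cauchy.\<close>

lemma sticky_map_converges_L2:
  assumes N: "N \<in> L2 unit_lebesgue" and V: "V \<in> L2 unit_lebesgue"
    and polar: "\<And>h. h \<in> mono_cone \<Longrightarrow> (\<integral>x. V x * h x \<partial>unit_lebesgue) \<le> 0"
  obtains v where "v \<in> L2 unit_lebesgue"
    "((\<lambda>t. \<integral>x. (sticky_map N V t x - v x)\<^sup>2 \<partial>unit_lebesgue) \<longlongrightarrow> 0) at_top"
proof -
  let ?P = "sticky_map N V"
  define F where "F t h = (\<integral>x. (N x - h x)\<^sup>2 \<partial>unit_lebesgue) - 2 * t * (\<integral>x. V x * h x \<partial>unit_lebesgue)" for t h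
  have X: "(\<lambda>x. N x + t * V x) \<in> L2 unit_lebesgue" for t
    by (intro L2_add L2_cmult N V)
  have P: "?P t \<in> mono_cone" for t
    unfolding sticky_map_def by (rule proj_mono_cone_in[OF X])
  define C where "C t = 2 * t * (\<integral>x. V x * N x \<partial>unit_lebesgue) + t\<^sup>2 * (\<integral>x. (V x)\<^sup>2 \<partial>unit_lebesgue)" for t
  have dist_F: "(\<integral>x. (N x + t * V x - h x)\<^sup>2 \<partial>unit_lebesgue) = F t h + C t"
    if h: "h \<in> mono_cone" for t h
  proof -
    note L = N V mono_cone_L2[OF h]
    have "(\<lambda>x. (N x + t * V x - h x)\<^sup>2) =
        (\<lambda>x. (N x - h x)\<^sup>2 + (2 * t * (V x * N x) - 2 * t * (V x * h x)) + t\<^sup>2 * (V x)\<^sup>2)"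
      by (rule ext) (simp add: power2_eq_square algebra_simps)
    then show ?thesis
      using L2_square_integrable[OF L2_diff[OF L(1,3)]] L2_mult_integrable[OF L(2,1)]
        L2_mult_integrable[OF L(2,3)] L2_square_integrable[OF L(2)]
      by (simp add: F_def C_def)
  qed
  have gap: "F t (?P t) + (\<integral>x. (?P t x - h x)\<^sup>2 \<partial>unit_lebesgue) / 2 \<le> F t h" if h: "h \<in> mono_cone" for t h
    using proj_mono_cone_gap[OF X h, of t] dist_F[OF h, of t] dist_F[OF P, of t t]
    unfolding sticky_map_def by simp
  have F_mono: "F s h \<le> F t h" if "s \<le> t" "h \<in> mono_cone" for s t h
    using mult_right_mono_neg[OF \<open>s \<le> t\<close> polar[OF that(2)]] by (simp add: F_def)
  define m where "m t = F t (?P t)" for t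
  have step: "(\<integral>x. (?P s x - ?P t x)\<^sup>2 \<partial>unit_lebesgue) / 2 \<le> m t - m s" if "s \<le> t" for s t
    using gap[OF P, of s t] F_mono[OF that P, of t] by (simp add: m_def)
  have m_le: "m t \<le> (\<integral>x. (N x)\<^sup>2 \<partial>unit_lebesgue)" for t
  proof -
    have "(\<lambda>_. 0) \<in> mono_cone"
      by (rule bounded_mono_in_mono_cone[of _ 0]) (auto simp: mono_on_def)
    from gap[OF this, of t] have "m t + (\<integral>x. (?P t x)\<^sup>2 \<partial>unit_lebesgue) / 2 \<le> (\<integral>x. (N x)\<^sup>2 \<partial>unit_lebesgue)"
      by (simp add: m_def F_def)
    moreover have "0 \<le> (\<integral>x. (?P t x)\<^sup>2 \<partial>unit_lebesgue)" by simp
    ultimately show ?thesis by linarith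
  qed
  then have bdd: "bdd_above (range m)"
    by (intro bdd_aboveI2)
  have "\<exists>T. \<forall>s\<ge>T. \<forall>t\<ge>T. (\<integral>x. (?P s x - ?P t x)\<^sup>2 \<partial>unit_lebesgue) \<le> e" if e: "0 < e" for e
  proof -
    have "Sup (range m) - e / 2 < Sup (range m)" using e by simp
    from less_cSupD[OF _ this] obtain T where T: "Sup (range m) - e / 2 < m T"
      by auto
    have le: "(\<integral>x. (?P s x - ?P t x)\<^sup>2 \<partial>unit_lebesgue) \<le> e" if "T \<le> s" "s \<le> t" for s t
    proof -
      have "0 \<le> (\<integral>x. (?P T x - ?P s x)\<^sup>2 \<partial>unit_lebesgue)" by simp
      moreover have "m t \<le> Sup (range m)"
        by (rule cSup_upper[OF _ bdd]) simp
      ultimately show ?thesis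
        using step[OF that(1)] step[OF that(2)] T by linarith
    qed
    have "(\<integral>x. (?P s x - ?P t x)\<^sup>2 \<partial>unit_lebesgue) \<le> e" if "T \<le> s" "T \<le> t" for s t
      using le[of s t] le[of t s] that by (cases "s \<le> t") (auto simp: power2_commute)
    then show ?thesis by blast
  qed
  from U.L2_complete_at_top[OF mono_cone_L2[OF P] this] show ?thesis
    using that by blast
qed

section \<open>Wasserstein distance\<close>

text \<open>Pushing \<open>M\<close> forward by the pair \<open>(f, g)\<close> gives an admissible coupling.\<close>

lemma W1_distr_le:
  assumes M: "prob_space M"
    and [measurable]: "f \<in> borel_measurable M" "g \<in> borel_measurable M"
  shows "W1 (distr M borel f) (distr M borel g) \<le> (\<integral>\<^sup>+x. ennreal \<bar>f x - g x\<bar> \<partial>M)"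
proof -
  let ?\<gamma> = "distr M (borel \<Otimes>\<^sub>M borel) (\<lambda>x. (f x, g x))"
  have "?\<gamma> \<in> couplings (distr M borel f) (distr M borel g)"
    unfolding couplings_def
    by (auto intro!: prob_space.prob_space_distr[OF M] simp: distr_distr comp_def)
  then have "W1 (distr M borel f) (distr M borel g) \<le> (\<integral>\<^sup>+p. ennreal \<bar>fst p - snd p\<bar> \<partial>?\<gamma>)"
    unfolding W1_def by (rule INF_lower)
  also have "\<dots> = (\<integral>\<^sup>+x. ennreal \<bar>f x - g x\<bar> \<partial>M)"
    by (subst nn_integral_distr) auto
  finally show ?thesis .
qed

text \<open>The triangle inequality, integrated against a coupling of cost less than \<open>c\<close>. It turns Wasserstein
  convergence into a uniform bound on first moments.\<close>

lemma first_moment_le_W1: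
  assumes "W1 \<mu> \<nu> < c"
  shows "(\<integral>\<^sup>+y. ennreal \<bar>y\<bar> \<partial>\<mu>) \<le> c + (\<integral>\<^sup>+y. ennreal \<bar>y\<bar> \<partial>\<nu>)"
proof -
  obtain \<gamma> where \<gamma>: "\<gamma> \<in> couplings \<mu> \<nu>" and less: "(\<integral>\<^sup>+p. ennreal \<bar>fst p - snd p\<bar> \<partial>\<gamma>) < c"
    using assms unfolding W1_def by (auto simp: INF_less_iff)
  have sets_\<gamma>: "sets \<gamma> = sets (borel \<Otimes>\<^sub>M borel)"
    and eq: "\<mu> = distr \<gamma> borel fst" "\<nu> = distr \<gamma> borel snd"
    using \<gamma> by (auto simp: couplings_def)
  have [measurable]: "fst \<in> borel_measurable \<gamma>" "snd \<in> borel_measurable \<gamma>"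
    by (simp_all add: measurable_cong_sets[OF sets_\<gamma> refl])
  have "(\<integral>\<^sup>+y. ennreal \<bar>y\<bar> \<partial>\<mu>) = (\<integral>\<^sup>+p. ennreal \<bar>fst p\<bar> \<partial>\<gamma>)"
    unfolding eq by (rule nn_integral_distr) measurable
  also have "\<dots> \<le> (\<integral>\<^sup>+p. ennreal \<bar>fst p - snd p\<bar> + ennreal \<bar>snd p\<bar> \<partial>\<gamma>)"
    by (intro nn_integral_mono) (auto simp flip: ennreal_plus intro!: ennreal_leI)
  also have "\<dots> = (\<integral>\<^sup>+p. ennreal \<bar>fst p - snd p\<bar> \<partial>\<gamma>) + (\<integral>\<^sup>+p. ennreal \<bar>snd p\<bar> \<partial>\<gamma>)"
    by (rule nn_integral_add) measurable
  also have "(\<integral>\<^sup>+p. ennreal \<bar>snd p\<bar> \<partial>\<gamma>) = (\<integral>\<^sup>+y. ennreal \<bar>y\<bar> \<partial>\<nu>)"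
    unfolding eq by (rule nn_integral_distr[symmetric]) measurable
  finally show ?thesis
    using less by (meson add_right_mono less_imp_le order_trans)
qed

section \<open>Convergence to equilibrium\<close>

lemma affine_bounded_above_slope:
  fixes a b C :: real
  assumes "\<forall>\<^sub>F t in at_top. a + t * b \<le> C"
  shows "b \<le> 0"
proof (rule ccontr)
  assume "\<not> b \<le> 0"
  then have "C < a + t * b" if "(C - a) / b < t" for t
    using that by (simp add: pos_divide_less_eq)
  then have "\<forall>\<^sub>F t in at_top. C < a + t * b"
    using eventually_gt_at_top by (rule eventually_mono[rotated])
  with assms have "\<forall>\<^sub>F t::real in at_top. False"
    by eventually_elim simp
  then show False by simp
qed

text \<open>The variational inequality bounds \<open>\<langle>N + t V, k\<rangle>\<close> by the pairing of \<open>k\<close> with the position at time \<open>t\<close>.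
  Since \<open>\<bar>k\<bar> \<le> 1\<close>, the latter is at most the first absolute moment of the density, which stays bounded near
  equilibrium. An affine function of \<open>t\<close> that stays bounded above has slope at most zero.\<close>

lemma equilibrium_velocity_polar:
  assumes N: "N \<in> L2 unit_lebesgue" and V: "V \<in> L2 unit_lebesgue"
    and conv: "converges_to_equilibrium (sticky_density N V)"
    and k: "mono_on {0<..<1} k" "\<And>x. \<bar>k x\<bar> \<le> 1"
  shows "(\<integral>x. V x * k x \<partial>unit_lebesgue) \<le> 0"
proof -
  obtain \<nu> where \<nu>: "\<nu> \<in> P2" and lim: "((\<lambda>t. W1 (sticky_density N V t) \<nu>) \<longlongrightarrow> 0) at_top"
    using conv by (auto simp: converges_to_equilibrium_def)
  interpret \<nu>: prob_space \<nu>
    using \<nu> by (simp add: P2_def)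
  have "integrable \<nu> (\<lambda>y. y)"
    using \<nu> by (intro \<nu>.square_integrable_imp_integrable[OF measurable_ident_sets]) (auto simp: P2_def)
  define C where "C = 1 + (\<integral>y. \<bar>y\<bar> \<partial>\<nu>)"
  have "0 \<le> C"
    unfolding C_def by (intro add_nonneg_nonneg Bochner_Integration.integral_nonneg) auto
  have kK: "k \<in> mono_cone"
    using k by (rule bounded_mono_in_mono_cone)
  let ?a = "\<integral>x. N x * k x \<partial>unit_lebesgue" and ?b = "\<integral>x. V x * k x \<partial>unit_lebesgue"
  have "\<forall>\<^sub>F t in at_top. W1 (sticky_density N V t) \<nu> < 1"
    by (rule order_tendstoD(2)[OF lim]) simp
  then have "\<forall>\<^sub>F t in at_top. ?a + t * ?b \<le> C"
  proof eventually_elim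
    case (elim t)
    let ?X = "\<lambda>x. N x + t * V x" and ?P = "sticky_map N V t"
    have X: "?X \<in> L2 unit_lebesgue"
      by (intro L2_add L2_cmult N V)
    have P: "?P \<in> L2 unit_lebesgue"
      unfolding sticky_map_def by (intro mono_cone_L2 proj_mono_cone_in X)
    note [measurable] = L2_measurable[OF P]
    have "ennreal (\<integral>x. \<bar>?P x\<bar> \<partial>unit_lebesgue) = (\<integral>\<^sup>+x. ennreal \<bar>?P x\<bar> \<partial>unit_lebesgue)"
      using U.L2_integrable[OF P] by (intro nn_integral_eq_integral[symmetric]) auto
    also have "\<dots> = (\<integral>\<^sup>+y. ennreal \<bar>y\<bar> \<partial>sticky_density N V t)"
      unfolding sticky_density_def by (subst nn_integral_distr) auto
    also have "\<dots> \<le> 1 + (\<integral>\<^sup>+y. ennreal \<bar>y\<bar> \<partial>\<nu>)"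
      by (rule first_moment_le_W1[OF elim])
    also have "\<dots> = ennreal C"
      using \<open>integrable \<nu> (\<lambda>y. y)\<close> by (simp add: C_def nn_integral_eq_integral)
    finally have PC: "(\<integral>x. \<bar>?P x\<bar> \<partial>unit_lebesgue) \<le> C"
      using \<open>0 \<le> C\<close> by (simp only: ennreal_le_iff)
    have "?a + t * ?b = (\<integral>x. ?X x * k x \<partial>unit_lebesgue)"
      using L2_mult_integrable[OF N mono_cone_L2[OF kK]] L2_mult_integrable[OF V mono_cone_L2[OF kK]]
      by (simp add: distrib_right mult.assoc)
    also have "\<dots> \<le> (\<integral>x. ?P x * k x \<partial>unit_lebesgue)"
      unfolding sticky_map_def by (rule proj_mono_cone_obtuse[OF X kK])
    also have "\<dots> \<le> (\<integral>x. \<bar>?P x\<bar> \<partial>unit_lebesgue)"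
    proof (rule integral_mono)
      fix x
      have "?P x * k x \<le> \<bar>?P x\<bar> * \<bar>k x\<bar>"
        by (metis abs_ge_self abs_mult)
      also have "\<dots> \<le> \<bar>?P x\<bar> * 1"
        by (intro mult_left_mono k) simp
      finally show "?P x * k x \<le> \<bar>?P x\<bar>" by simp
    qed (use L2_mult_integrable[OF P mono_cone_L2[OF kK]] U.L2_integrable[OF P] in auto)
    finally show ?case using PC by linarith
  qed
  then show ?thesis
    by (rule affine_bounded_above_slope)
qed

theorem theorem3p10:
  fixes \<rho>0 :: "real measure" and v0 N0 V0 :: "real \<Rightarrow> real"
  assumes "\<rho>0 \<in> P2"
    and "v0 \<in> L2 \<rho>0"
    and "optimal_map \<rho>0 N0"
    and "V0 = v0 \<circ> N0"
  shows "converges_to_equilibrium (sticky_density N0 V0) \<longleftrightarrow>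
    (LBINT w:{0<..<1}. V0 w) = 0 \<and> (\<forall>x\<in>{0<..<1}. (LBINT w:{0<..<x}. V0 w) \<ge> 0)"
proof -
  have N0_meas [measurable]: "N0 \<in> borel_measurable unit_lebesgue"
    and \<rho>0: "\<rho>0 = distr unit_lebesgue borel N0"
    using assms(3) by (auto simp: optimal_map_def)
  have v0_meas [measurable]: "v0 \<in> borel_measurable borel"
    using assms(2) by (simp add: L2_def \<rho>0)
  have N: "N0 \<in> L2 unit_lebesgue"
    using assms(1) by (simp add: P2_def L2_def \<rho>0 integrable_distr_eq)
  have V: "V0 \<in> L2 unit_lebesgue"
    using assms(2) by (simp add: L2_def \<rho>0 integrable_distr_eq assms(4) comp_def)
  show ?thesis
  proof
    assume conv: "converges_to_equilibrium (sticky_density N0 V0)"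
    \<comment> \<open>The test functions \<open>1\<close> and \<open>-1\<close> give the total integral; minus the indicator of \<open>(0, x)\<close>, a step from
      \<open>-1\<close> up to \<open>0\<close>, gives the primitive at \<open>x\<close>.\<close>
    note polar = equilibrium_velocity_polar[OF N V conv]
    have "(\<integral>x. V0 x \<partial>unit_lebesgue) \<le> 0" "0 \<le> (\<integral>x. V0 x \<partial>unit_lebesgue)"
      using polar[of "\<lambda>_. 1"] polar[of "\<lambda>_. -1"] by (auto simp: mono_on_def)
    moreover have "(LBINT w:{0<..<x}. V0 w) \<ge> 0" if x: "x \<in> {0<..<1}" for x
    proof -
      have "(\<integral>w. V0 w * - indicator {0<..<x} w \<partial>unit_lebesgue) \<le> 0"
        by (rule polar) (auto simp: mono_on_def indicator_def)
      then have "0 \<le> (\<integral>w. indicator {0<..<x} w * V0 w \<partial>unit_lebesgue)"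
        by (simp add: mult.commute)
      also have "\<dots> = (LBINT w:{0<..<x}. V0 w)"
        using x by (intro integral_unit_lebesgue_initial) simp
      finally show ?thesis .
    qed
    ultimately show "(LBINT w:{0<..<1}. V0 w) = 0 \<and> (\<forall>x\<in>{0<..<1}. (LBINT w:{0<..<x}. V0 w) \<ge> 0)"
      by (auto simp: integral_unit_lebesgue)
  next
    assume "(LBINT w:{0<..<1}. V0 w) = 0 \<and> (\<forall>x\<in>{0<..<1}. (LBINT w:{0<..<x}. V0 w) \<ge> 0)"
    then have "(\<integral>x. V0 x * h x \<partial>unit_lebesgue) \<le> 0" if "h \<in> mono_cone" for h
      using nonneg_primitive_in_polar_cone[OF V that] by blast
    from sticky_map_converges_L2[OF N V this] obtain v where v: "v \<in> L2 unit_lebesgue"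
      and lim: "((\<lambda>t. \<integral>x. (sticky_map N0 V0 t x - v x)\<^sup>2 \<partial>unit_lebesgue) \<longlongrightarrow> 0) at_top"
      by blast
    let ?\<nu> = "distr unit_lebesgue borel v"
    have [measurable]: "v \<in> borel_measurable unit_lebesgue"
      by (rule L2_measurable[OF v])
    have "?\<nu> \<in> P2"
      using L2_square_integrable[OF v]
      by (simp add: P2_def integrable_distr_eq U.prob_space_distr)
    moreover have "((\<lambda>t. W1 (sticky_density N0 V0 t) ?\<nu>) \<longlongrightarrow> 0) at_top"
    proof (rule tendsto_sandwich[OF _ _ tendsto_const[of 0]])
      have "W1 (sticky_density N0 V0 t) ?\<nu>
          \<le> ennreal (sqrt (\<integral>x. (sticky_map N0 V0 t x - v x)\<^sup>2 \<partial>unit_lebesgue))" for t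
      proof -
        have P: "sticky_map N0 V0 t \<in> L2 unit_lebesgue"
          unfolding sticky_map_def by (intro mono_cone_L2 proj_mono_cone_in L2_add L2_cmult N V)
        note D = L2_diff[OF P v]
        have "W1 (sticky_density N0 V0 t) ?\<nu> \<le> (\<integral>\<^sup>+x. ennreal \<bar>sticky_map N0 V0 t x - v x\<bar> \<partial>unit_lebesgue)"
          unfolding sticky_density_def
          by (rule W1_distr_le[OF prob_space_unit_lebesgue L2_measurable[OF P] L2_measurable[OF v]])
        also have "\<dots> = ennreal (\<integral>x. \<bar>sticky_map N0 V0 t x - v x\<bar> \<partial>unit_lebesgue)"
          using U.L2_integrable[OF D] by (intro nn_integral_eq_integral) auto
        also have "\<dots> \<le> ennreal (sqrt (\<integral>x. (sticky_map N0 V0 t x - v x)\<^sup>2 \<partial>unit_lebesgue))"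
          by (intro ennreal_leI U.integral_abs_le_L2 D)
        finally show ?thesis .
      qed
      then show "\<forall>\<^sub>F t in at_top. W1 (sticky_density N0 V0 t) ?\<nu>
          \<le> ennreal (sqrt (\<integral>x. (sticky_map N0 V0 t x - v x)\<^sup>2 \<partial>unit_lebesgue))"
        by simp
      show "((\<lambda>t. ennreal (sqrt (\<integral>x. (sticky_map N0 V0 t x - v x)\<^sup>2 \<partial>unit_lebesgue))) \<longlongrightarrow> 0) at_top"
        using tendsto_ennrealI[OF tendsto_real_sqrt[OF lim]] by simp
    qed simp_all
    ultimately show "converges_to_equilibrium (sticky_density N0 V0)"
      by (auto simp: converges_to_equilibrium_def sticky_density_def)
  qed
qed

end
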